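(* Let $\mathbf{S}$ be a schema, let $\mathcal{C}$ be a collection of $\mathbf{S}$-structures (closed under isomorphism), and let $n,m\geq 0$ with $n+m>0$ and $\ell>0$ be integers. The following are equivalent: (1) $\mathcal{C}$ is finitely axiomatizable by guarded $(n,m,\ell)$-dexrs; (2) $\mathcal{C}$ is critical, closed under repairable direct products, and guarded-diagrammatically $(n,m,\ell)$-compatible.
   Context: Fix a countably infinite set $\mathbf{C}$ of constants and a disjoint set of variables. A schema $\mathbf{S}$ is a finite set of relation symbols, each with a positive arity $\mathrm{ar}(R)$. An $\mathbf{S}$-structure $I$ consists of a (finite or infinite) domain $\mathrm{dom}(I)\subseteq\mathbf{C}$ and a relation $R^I\subseteq\mathrm{dom}(I)^{\mathrm{ar}(R)}$ for each $R\in\mathbf{S}$. Its facts are the expressions $R(\bar c)$ with $\bar c\in R^I$, forming $\mathrm{facts}(I)$; its active domain $\mathrm{adom}(I)$ is the set of elements occurring in some fact. $J\subseteq I$ means $\mathrm{facts}(J)\subseteq\mathrm{facts}(I)$; $J\preceq I$ ($J$ a substructure of $I$) means $\mathrm{dom}(J)\subseteq\mathrm{dom}(I)$ and $R^J=R^I\cap\mathrm{dom}(J)^{\mathrm{ar}(R)}$ for each $R$. Homomorphisms and isomorphisms are as usual; all collections of structures are assumed closed under isomorphism. A disjunctive existential rule (dexr) over $\mathbf{S}$ is a constant-free sentence $\forall\bar x\forall\bar y\,(\phi(\bar x,\bar y)\rightarrow\bigvee_{i=1}^k\exists\bar z_i\,\psi_i(\bar x_i,\bar z_i))$ where $k>0$,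 $\phi$ is a (possibly empty) conjunction of atoms over $\mathbf{S}$ (atoms $R(\bar v)$ with $\bar v$ a tuple of variables), each $\psi_i$ is a non-empty conjunction of atoms, the variables of $\bar x_i$ occur in $\bar x$, and each variable of $\bar x$ occurs in some $\bar x_i$; usual first-order semantics. It is an $(n,m,\ell)$-dexr if its body mentions at most $n$ variables, each head disjunct has at most $m$ existentially quantified variables, and there are at most $\ell$ head disjuncts. It is guarded if its body is empty or contains an atom mentioning all universally quantified variables. $\mathcal{C}$ is finitely axiomatizable by a class of dexrs if there is a finite set $\Sigma$ of dexrs over $\mathbf{S}$ from that class with: $I\in\mathcal{C}$ iff $I\models\Sigma$, for every $\mathbf{S}$-structure $I$. Criticality: $I$ is $\kappa$-critical if $|\mathrm{dom}(I)|=\kappa$ and $R^I=\mathrm{dom}(I)^{\mathrm{ar}(R)}$ for all $R$; $\mathcal{C}$ is critical if for every $\kappa>0$ it contains a $\kappa$-critical structure. Repairable direct products: $I\otimes J$ has domain $\mathrm{dom}(I)\times\mathrm{dom}(J)$ and $((a_1,b_1),\dots,(a_r,b_r))\in R^{I\otimes J}$ iff $(a_1,\dots,a_r)\in R^I$ and $(b_1,\dots,b_r)\in R^J$; $\pi(a,b)=a$. A repairable direct product of $I$ and $J$ is an $\mathbf{S}$-structure $L$ with $I\otimes J\subseteq L$ such that some extension of $\pi$ is a homomorphism from $L$ to $I$. $\mathcal{C}$ is closed under repairable direct products if for all $I,J\in\mathcal{C}$ some repairable direct product of $I$ and $J$ is in $\mathcal{C}$. Diagrams: sentences may mention constants, interpreted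 as themselves. For an $\mathbf{S}$-structure $I$, a finite $K\subseteq I$ with $\mathrm{dom}(K)=\mathrm{adom}(K)$, and $m\geq0$: with distinct variables $y_1,\dots,y_m$, $A_{K,m}$ is the set of atoms $R(\bar u)$, $R\in\mathbf{S}$, $\bar u\in(\mathrm{dom}(K)\cup\{y_1,\dots,y_m\})^{\mathrm{ar}(R)}$; $C_{K,m}$ the set of conjunctions of such atoms; $N^I_{K,m}=\{\gamma(\bar y)\in C_{K,m}:I\not\models\exists\bar y\,\gamma(\bar y)\}$. For $G\subseteq N^I_{K,m}$, $\Delta^I_{K,G}=\bigwedge_{\alpha\in\mathrm{facts}(K)}\alpha\wedge\bigwedge_{c\neq d\in\mathrm{dom}(K)}\neg(c=d)\wedge\bigwedge_{\gamma\in G}\neg\exists\bar y\,\gamma(\bar y)$; it is an $(m,\ell)$-diagram of $K$ relative to $I$ if $|G|\leq\ell$. A structure $K$ is guarded if $\mathrm{facts}(K)=\emptyset$ or there is a fact $R(c_1,\dots,c_r)\in\mathrm{facts}(K)$ with $\mathrm{adom}(K)=\{c_1,\dots,c_r\}$. $\mathcal{C}$ is guarded-diagrammatically $(n,m,\ell)$-compatible with $I$ if for every guarded $K\preceq I$ with $\mathrm{dom}(K)=\mathrm{adom}(K)$ and $|\mathrm{dom}(K)|\leq n$, and every $(m,\ell)$-diagram $\Delta$ of $K$ relative to $I$, some $J\in\mathcal{C}$ satisfies $\Delta$. $\mathcal{C}$ is guarded-diagrammatically $(n,m,\ell)$-compatible if every $\mathbf{S}$-structure $I$ with which $\mathcal{C}$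 is guarded-diagrammatically $(n,m,\ell)$-compatible belongs to $\mathcal{C}$. *)

theory Defs
  imports Main "HOL-Library.Countable"
begin

text \<open>
  The set of constants is the universe of the type variable \<open>'c\<close>; the main result assumes it to be
  countably infinite. Tuples are lists. The empty domain is allowed.
\<close>

record 'r schema =
  Syms :: "'r set"
  ar :: "'r \<Rightarrow> nat"

definition is_schema :: "'r schema \<Rightarrow> bool" where
  "is_schema S \<longleftrightarrow> finite (Syms S) \<and> (\<forall>R\<in>Syms S. ar S R > 0)"

record ('r, 'c) struct =
  Dom :: "'c set"
  Rel :: "'r \<Rightarrow> 'c list set"

text \<open>Symbols outside the schema get the empty relation, so that equality of structures is
  equality of domains and of the relations of the schema.\<close>

definition is_struct :: "'r schema \<Rightarrow> ('r, 'c) struct \<Rightarrow> bool" where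
  "is_struct S I \<longleftrightarrow>
     (\<forall>R\<in>Syms S. \<forall>cs\<in>Rel I R. length cs = ar S R \<and> set cs \<subseteq> Dom I) \<and>
     (\<forall>R. R \<notin> Syms S \<longrightarrow> Rel I R = {})"

datatype ('r, 't) atom = Atom (sym: 'r) (args: "'t list")

definition facts :: "('r, 'c) struct \<Rightarrow> ('r, 'c) atom set" where
  "facts I = {Atom R cs | R cs. cs \<in> Rel I R}"

definition adom :: "('r, 'c) struct \<Rightarrow> 'c set" where
  "adom I = (\<Union>f\<in>facts I. set (args f))"

definition contained :: "('r, 'c) struct \<Rightarrow> ('r, 'c) struct \<Rightarrow> bool" where
  "contained J I \<longleftrightarrow> facts J \<subseteq> facts I"

definition substruct :: "'r schema \<Rightarrow> ('r, 'c) struct \<Rightarrow> ('r, 'c) struct \<Rightarrow> bool" where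
  "substruct S J I \<longleftrightarrow>
     is_struct S J \<and> is_struct S I \<and> Dom J \<subseteq> Dom I \<and>
     (\<forall>R\<in>Syms S. Rel J R = Rel I R \<inter> {cs. length cs = ar S R \<and> set cs \<subseteq> Dom J})"

definition is_hom :: "('a \<Rightarrow> 'b) \<Rightarrow> ('r, 'a) struct \<Rightarrow> ('r, 'b) struct \<Rightarrow> bool" where
  "is_hom h I J \<longleftrightarrow> h ` Dom I \<subseteq> Dom J \<and> (\<forall>R. \<forall>cs\<in>Rel I R. map h cs \<in> Rel J R)"

definition is_iso :: "('a \<Rightarrow> 'b) \<Rightarrow> ('r, 'a) struct \<Rightarrow> ('r, 'b) struct \<Rightarrow> bool" where
  "is_iso h I J \<longleftrightarrow>
     bij_betw h (Dom I) (Dom J) \<and> is_hom h I J \<and> is_hom (inv_into (Dom I) h) J I"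

definition iso_closed :: "'r schema \<Rightarrow> ('r, 'c) struct set \<Rightarrow> bool" where
  "iso_closed S C \<longleftrightarrow> (\<forall>I\<in>C. \<forall>J. is_struct S J \<longrightarrow> (\<exists>h. is_iso h I J) \<longrightarrow> J \<in> C)"


section \<open>Disjunctive existential rules\<close>

text \<open>
  The universally quantified variables of a rule are the variables occurring in its body, and
  the existentially quantified variables of a head disjunct are its variables that do not
  occur in the body. Hence the quantifier prefixes need not be recorded.
\<close>

record 'r dexr =
  body :: "('r, nat) atom list"
  heads :: "('r, nat) atom list list"

definition vars :: "('r, nat) atom list \<Rightarrow> nat set" where
  "vars as = (\<Union>a\<in>set as. set (args a))"

definition ex_vars :: "'r dexr \<Rightarrow> ('r, nat) atom list \<Rightarrow> nat set" where
  "ex_vars \<sigma> \<psi> = vars \<psi> - vars (body \<sigma>)"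

definition is_dexr :: "'r schema \<Rightarrow> 'r dexr \<Rightarrow> bool" where
  "is_dexr S \<sigma> \<longleftrightarrow>
     heads \<sigma> \<noteq> [] \<and> (\<forall>\<psi>\<in>set (heads \<sigma>). \<psi> \<noteq> []) \<and>
     (\<forall>a \<in> set (body \<sigma>) \<union> \<Union> (set ` set (heads \<sigma>)).
        sym a \<in> Syms S \<and> length (args a) = ar S (sym a))"

text \<open>Truth of a conjunction of atoms, the argument terms being evaluated by \<open>v\<close>.\<close>

definition holds :: "('r, 'c) struct \<Rightarrow> ('t \<Rightarrow> 'c) \<Rightarrow> ('r, 't) atom list \<Rightarrow> bool" where
  "holds I v as \<longleftrightarrow> (\<forall>a\<in>set as. Atom (sym a) (map v (args a)) \<in> facts I)"

definition sat_dexr :: "('r, 'c) struct \<Rightarrow> 'r dexr \<Rightarrow> bool" where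
  "sat_dexr I \<sigma> \<longleftrightarrow>
     (\<forall>v. v ` vars (body \<sigma>) \<subseteq> Dom I \<and> holds I v (body \<sigma>) \<longrightarrow>
        (\<exists>\<psi>\<in>set (heads \<sigma>). \<exists>w. (\<forall>x\<in>vars (body \<sigma>). w x = v x) \<and>
            w ` ex_vars \<sigma> \<psi> \<subseteq> Dom I \<and> holds I w \<psi>))"

definition nml_dexr :: "nat \<Rightarrow> nat \<Rightarrow> nat \<Rightarrow> 'r dexr \<Rightarrow> bool" where
  "nml_dexr n m l \<sigma> \<longleftrightarrow>
     card (vars (body \<sigma>)) \<le> n \<and> (\<forall>\<psi>\<in>set (heads \<sigma>). card (ex_vars \<sigma> \<psi>) \<le> m) \<and>
     length (heads \<sigma>) \<le> l"

definition guarded_dexr :: "'r dexr \<Rightarrow> bool" where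
  "guarded_dexr \<sigma> \<longleftrightarrow>
     body \<sigma> = [] \<or> (\<exists>a\<in>set (body \<sigma>). vars (body \<sigma>) \<subseteq> set (args a))"

definition finitely_axiomatizable ::
    "'r schema \<Rightarrow> ('r, 'c) struct set \<Rightarrow> ('r dexr \<Rightarrow> bool) \<Rightarrow> bool" where
  "finitely_axiomatizable S C P \<longleftrightarrow>
     (\<exists>\<Sigma>. finite \<Sigma> \<and> (\<forall>\<sigma>\<in>\<Sigma>. is_dexr S \<sigma> \<and> P \<sigma>) \<and>
        (\<forall>I. is_struct S I \<longrightarrow> (I \<in> C \<longleftrightarrow> (\<forall>\<sigma>\<in>\<Sigma>. sat_dexr I \<sigma>))))"


section \<open>Criticality\<close>

text \<open>The cardinality \<open>\<kappa>\<close> ranges over the positive integers (no structure has an uncountable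
  domain).\<close>

definition k_critical :: "'r schema \<Rightarrow> nat \<Rightarrow> ('r, 'c) struct \<Rightarrow> bool" where
  "k_critical S \<kappa> I \<longleftrightarrow>
     is_struct S I \<and> finite (Dom I) \<and> card (Dom I) = \<kappa> \<and>
     (\<forall>R\<in>Syms S. Rel I R = {cs. length cs = ar S R \<and> set cs \<subseteq> Dom I})"

definition critical :: "'r schema \<Rightarrow> ('r, 'c) struct set \<Rightarrow> bool" where
  "critical S C \<longleftrightarrow> (\<forall>\<kappa>>0. \<exists>I\<in>C. k_critical S \<kappa> I)"


section \<open>Repairable direct products\<close>

definition direct_product ::
    "('r, 'a) struct \<Rightarrow> ('r, 'b) struct \<Rightarrow> ('r, 'a \<times> 'b) struct"  (infixr "\<otimes>" 70) where
  "I \<otimes> J = \<lparr>Dom = Dom I \<times> Dom J,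
            Rel = (\<lambda>R. {ps. map fst ps \<in> Rel I R \<and> map snd ps \<in> Rel J R})\<rparr>"

definition rename :: "('a \<Rightarrow> 'b) \<Rightarrow> ('r, 'a) struct \<Rightarrow> ('r, 'b) struct" where
  "rename e I = \<lparr>Dom = e ` Dom I, Rel = (\<lambda>R. map e ` Rel I R)\<rparr>"

text \<open>
  The elements of \<open>I \<otimes> J\<close> are pairs, not constants, so the product is considered up to an
  injective renaming \<open>e\<close> of pairs into constants; for collections closed under isomorphism the
  choice of \<open>e\<close> is immaterial. A homomorphism from \<open>L\<close> has domain \<open>Dom L\<close>, so it can extend
  the projection only if \<open>Dom L\<close> contains the elements of the product, including those that
  occur in no fact.
\<close>

definition repairable_product ::
    "'r schema \<Rightarrow> ('r, 'c) struct \<Rightarrow> ('r, 'c) struct \<Rightarrow> ('r, 'c) struct \<Rightarrow> bool" where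
  "repairable_product S I J L \<longleftrightarrow>
     is_struct S L \<and>
     (\<exists>e. inj_on e (Dom (I \<otimes> J)) \<and> contained (rename e (I \<otimes> J)) L \<and>
        (\<exists>h. is_hom h L I \<and>
             e ` Dom (I \<otimes> J) \<subseteq> Dom L \<and> (\<forall>p\<in>Dom (I \<otimes> J). h (e p) = fst p)))"

definition closed_repairable_products :: "'r schema \<Rightarrow> ('r, 'c) struct set \<Rightarrow> bool" where
  "closed_repairable_products S C \<longleftrightarrow>
     (\<forall>I\<in>C. \<forall>J\<in>C. \<exists>L\<in>C. repairable_product S I J L)"


section \<open>Diagrams\<close>

datatype 'c trm = Const 'c | Var nat

primrec eval_trm :: "(nat \<Rightarrow> 'c) \<Rightarrow> 'c trm \<Rightarrow> 'c" where
  "eval_trm v (Const c) = c"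
| "eval_trm v (Var i) = v i"

definition sat_ex :: "('r, 'c) struct \<Rightarrow> nat \<Rightarrow> ('r, 'c trm) atom list \<Rightarrow> bool" where
  "sat_ex I m \<gamma> \<longleftrightarrow> (\<exists>v. v ` {..<m} \<subseteq> Dom I \<and> holds I (eval_trm v) \<gamma>)"

definition diag_atoms :: "'r schema \<Rightarrow> ('r, 'c) struct \<Rightarrow> nat \<Rightarrow> ('r, 'c trm) atom set" where
  "diag_atoms S K m =
     {Atom R us | R us. R \<in> Syms S \<and> length us = ar S R \<and>
        set us \<subseteq> Const ` Dom K \<union> Var ` {..<m}}"

text \<open>Conjunctions are non-empty, as in rule heads. Over the empty structure the empty
  conjunction would yield the condition that the domain is empty, which no rule expresses.\<close>

definition diag_conjs :: "'r schema \<Rightarrow> ('r, 'c) struct \<Rightarrow> nat \<Rightarrow> ('r, 'c trm) atom list set" where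
  "diag_conjs S K m = {\<gamma>. \<gamma> \<noteq> [] \<and> set \<gamma> \<subseteq> diag_atoms S K m}"

definition neg_conjs ::
    "'r schema \<Rightarrow> ('r, 'c) struct \<Rightarrow> ('r, 'c) struct \<Rightarrow> nat \<Rightarrow> ('r, 'c trm) atom list set" where
  "neg_conjs S I K m = {\<gamma> \<in> diag_conjs S K m. \<not> sat_ex I m \<gamma>}"

text \<open>A diagram is represented by the set of its conjuncts.\<close>

datatype ('r, 'c) conjunct =
    Fact "('r, 'c) atom"
  | Neq 'c 'c
  | NotEx nat "('r, 'c trm) atom list"

primrec sat_conjunct :: "('r, 'c) struct \<Rightarrow> ('r, 'c) conjunct \<Rightarrow> bool" where
  "sat_conjunct J (Fact f) \<longleftrightarrow> f \<in> facts J"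
| "sat_conjunct J (Neq c d) \<longleftrightarrow> c \<noteq> d"
| "sat_conjunct J (NotEx m \<gamma>) \<longleftrightarrow> \<not> sat_ex J m \<gamma>"

definition diagram ::
    "('r, 'c) struct \<Rightarrow> nat \<Rightarrow> ('r, 'c trm) atom list set \<Rightarrow> ('r, 'c) conjunct set" where
  "diagram K m G =
     Fact ` facts K \<union> {Neq c d | c d. c \<in> Dom K \<and> d \<in> Dom K \<and> c \<noteq> d} \<union> NotEx m ` G"

definition is_diagram ::
    "'r schema \<Rightarrow> nat \<Rightarrow> nat \<Rightarrow> ('r, 'c) struct \<Rightarrow> ('r, 'c) struct \<Rightarrow> ('r, 'c) conjunct set \<Rightarrow> bool"
  where
  "is_diagram S m l I K \<Delta> \<longleftrightarrow>
     (\<exists>G \<subseteq> neg_conjs S I K m. finite G \<and> card G \<le> l \<and> \<Delta> = diagram K m G)"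

definition guarded_struct :: "('r, 'c) struct \<Rightarrow> bool" where
  "guarded_struct K \<longleftrightarrow> facts K = {} \<or> (\<exists>f\<in>facts K. adom K = set (args f))"

definition guarded_diag_compatible_with ::
    "'r schema \<Rightarrow> ('r, 'c) struct set \<Rightarrow> nat \<Rightarrow> nat \<Rightarrow> nat \<Rightarrow> ('r, 'c) struct \<Rightarrow> bool" where
  "guarded_diag_compatible_with S C n m l I \<longleftrightarrow>
     (\<forall>K. substruct S K I \<and> guarded_struct K \<and> Dom K = adom K \<and>
          finite (Dom K) \<and> card (Dom K) \<le> n \<longrightarrow>
        (\<forall>\<Delta>. is_diagram S m l I K \<Delta> \<longrightarrow> (\<exists>J\<in>C. \<forall>\<delta>\<in>\<Delta>. sat_conjunct J \<delta>)))"

definition guarded_diag_compatible ::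
    "'r schema \<Rightarrow> ('r, 'c) struct set \<Rightarrow> nat \<Rightarrow> nat \<Rightarrow> nat \<Rightarrow> bool" where
  "guarded_diag_compatible S C n m l \<longleftrightarrow>
     (\<forall>I. is_struct S I \<longrightarrow> guarded_diag_compatible_with S C n m l I \<longrightarrow> I \<in> C)"

end

theory Submission imports Defs begin

text \<open>
  From rules to closure properties, the product of \<open>I\<close> with a total structure is a repairable
  direct product that satisfies every rule satisfied by \<open>I\<close>, because rules do not mention
  equality; and a violated rule turns into a diagram (body image plus negated heads) that no model
  satisfies.

  Conversely, take the finitely many guarded rules valid in \<open>C\<close>, up to renaming of variables. A
  diagram \<open>\<Delta>\<close> of a structure \<open>I\<close> unsatisfiable in \<open>C\<close> reads as such a rule, violated by \<open>I\<close>, except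
  for its inequalities. These are harmless: a possibly non-injective homomorphism from \<open>K\<close> to
  \<open>J \<in> C\<close> that refutes all the negated conjunctions lifts to an injective one into a repairable
  product of \<open>J\<close> with a large critical structure, and the homomorphism back to \<open>J\<close> keeps the
  conjunctions refuted.
\<close>

section \<open>Conjunctions of atoms\<close>

lemma Atom_in_facts [simp]: "Atom R cs \<in> facts I \<longleftrightarrow> cs \<in> Rel I R"
  by (auto simp: facts_def)

lemma holds_iff_Rel: "holds I v as \<longleftrightarrow> (\<forall>a\<in>set as. map v (args a) \<in> Rel I (sym a))"
  by (simp add: holds_def)

lemma holds_cong:
  assumes "\<And>a t. a \<in> set as \<Longrightarrow> t \<in> set (args a) \<Longrightarrow> v t = w t"
  shows "holds I v as \<longleftrightarrow> holds I w as"
proof -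
  have "map v (args a) = map w (args a)" if "a \<in> set as" for a
    using assms that by simp
  then show ?thesis unfolding holds_iff_Rel by (intro ball_cong refl) (simp only:)
qed

lemma holds_map_atom: "holds I v (map (map_atom id f) as) \<longleftrightarrow> holds I (v \<circ> f) as"
  by (simp add: holds_iff_Rel atom.map_sel)

lemma holds_hom:
  assumes "is_hom h I J" and "holds I v as"
  shows "holds J (h \<circ> v) as"
  using assms unfolding is_hom_def holds_iff_Rel by (metis map_map)

text \<open>True atoms are facts, and facts respect the schema. Truth alone therefore confines the
  values of all occurring terms to the domain.\<close>

lemma holds_in_schema:
  assumes "is_struct S I" and "holds I v as" and "a \<in> set as"
  shows "sym a \<in> Syms S" and "length (args a) = ar S (sym a)"
    and "\<And>t. t \<in> set (args a) \<Longrightarrow> v t \<in> Dom I"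
proof -
  have r: "map v (args a) \<in> Rel I (sym a)"
    using assms by (simp add: holds_iff_Rel)
  then show s: "sym a \<in> Syms S"
    using assms(1) by (auto simp: is_struct_def)
  have "length (map v (args a)) = ar S (sym a) \<and> set (map v (args a)) \<subseteq> Dom I"
    using r s assms(1) unfolding is_struct_def by blast
  then show "length (args a) = ar S (sym a)" "\<And>t. t \<in> set (args a) \<Longrightarrow> v t \<in> Dom I"
    by auto
qed

lemma adom_subset_Dom:
  assumes "is_struct S I"
  shows "adom I \<subseteq> Dom I"
proof
  fix x assume "x \<in> adom I"
  then obtain R cs where r: "cs \<in> Rel I R" "x \<in> set cs"
    by (auto simp: adom_def facts_def)
  then have "R \<in> Syms S" using assms by (auto simp: is_struct_def)
  with r show "x \<in> Dom I" using assms unfolding is_struct_def by blast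
qed

text \<open>Positive arities and non-empty conjunctions make the domain non-empty, which takes care of
  variables that are quantified but do not occur.\<close>

lemma sat_ex_iff:
  assumes "is_schema S" and "is_struct S I" and "\<gamma> \<noteq> []"
  shows "sat_ex I m \<gamma> \<longleftrightarrow> (\<exists>v. holds I (eval_trm v) \<gamma>)"
proof
  assume "\<exists>v. holds I (eval_trm v) \<gamma>"
  then obtain v where v: "holds I (eval_trm v) \<gamma>" ..
  note h = holds_in_schema[OF assms(2) v]
  obtain a where a: "a \<in> set \<gamma>" using assms(3) by (cases \<gamma>) auto
  have "args a \<noteq> []" using h(1,2)[OF a] assms(1) by (auto simp: is_schema_def)
  then have "hd (args a) \<in> set (args a)" by simp
  with h(3)[OF a] obtain d where d: "d \<in> Dom I" by blast
  define w where "w = (\<lambda>i. if v i \<in> Dom I then v i else d)"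
  have "eval_trm v t = eval_trm w t" if "a \<in> set \<gamma>" "t \<in> set (args a)" for a t
    using h(3)[OF that] by (cases t) (auto simp: w_def)
  then have "holds I (eval_trm w) \<gamma>" by (rule iffD1[OF holds_cong v])
  moreover have "w ` {..<m} \<subseteq> Dom I" by (auto simp: w_def d)
  ultimately show "sat_ex I m \<gamma>" unfolding sat_ex_def by blast
qed (auto simp: sat_ex_def)

text \<open>Every quantified variable of a rule occurs in one of its atoms, and a true atom has its
  values in the domain, so the domain conditions of \<open>sat_dexr\<close> follow from
  truth.\<close>

lemma sat_dexr_iff:
  assumes "is_struct S I"
  shows "sat_dexr I \<sigma> \<longleftrightarrow> (\<forall>v. holds I v (body \<sigma>) \<longrightarrow>
    (\<exists>\<psi>\<in>set (heads \<sigma>). \<exists>w. (\<forall>x\<in>vars (body \<sigma>). w x = v x) \<and> holds I w \<psi>))"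
proof -
  have "v ` vars as \<subseteq> Dom I" if "holds I v as" for v and as :: "('a, nat) atom list"
    using holds_in_schema(3)[OF assms that] by (auto simp: vars_def)
  then have "v ` vars (body \<sigma>) \<subseteq> Dom I \<and> holds I v (body \<sigma>) \<longleftrightarrow> holds I v (body \<sigma>)"
    and "v ` ex_vars \<sigma> \<psi> \<subseteq> Dom I \<and> holds I v \<psi> \<longleftrightarrow> holds I v \<psi>" for v \<psi>
    unfolding ex_vars_def by blast+
  then show ?thesis unfolding sat_dexr_def by simp
qed


section \<open>From rules to closure properties\<close>

text \<open>When all tuples are facts, every head disjunct is true under every valuation into the
  domain, so any element \<open>d\<close> serves as value of the existential variables.\<close>

lemma full_struct_sat_dexr:
  assumes "is_dexr S \<sigma>" and "is_struct S I" and "Dom I \<noteq> {}"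
    and full: "\<And>R. R \<in> Syms S \<Longrightarrow> Rel I R = {cs. length cs = ar S R \<and> set cs \<subseteq> Dom I}"
  shows "sat_dexr I \<sigma>"
  unfolding sat_dexr_iff[OF assms(2)]
proof (intro allI impI)
  fix v assume v: "holds I v (body \<sigma>)"
  obtain d where d: "d \<in> Dom I" using assms(3) by blast
  obtain \<psi> where \<psi>: "\<psi> \<in> set (heads \<sigma>)"
    using assms(1) by (cases "heads \<sigma>") (auto simp: is_dexr_def)
  define w where "w = (\<lambda>x. if x \<in> vars (body \<sigma>) then v x else d)"
  have w: "w x \<in> Dom I" for x
    using holds_in_schema(3)[OF assms(2) v] d by (auto simp: w_def vars_def)
  have "holds I w \<psi>"
    unfolding holds_iff_Rel
  proof
    fix a assume "a \<in> set \<psi>"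
    then have "sym a \<in> Syms S" "length (args a) = ar S (sym a)"
      using assms(1) \<psi> unfolding is_dexr_def by blast+
    then show "map w (args a) \<in> Rel I (sym a)"
      using full w by auto
  qed
  then show "\<exists>\<psi>\<in>set (heads \<sigma>). \<exists>w. (\<forall>x\<in>vars (body \<sigma>). w x = v x) \<and> holds I w \<psi>"
    using \<psi> by (intro bexI[of _ \<psi>] exI[of _ w]) (auto simp: w_def)
qed

definition full_struct :: "'r schema \<Rightarrow> 'c set \<Rightarrow> ('r, 'c) struct" where
  "full_struct S D =
     \<lparr>Dom = D, Rel = (\<lambda>R. {cs. R \<in> Syms S \<and> length cs = ar S R \<and> set cs \<subseteq> D})\<rparr>"

lemma full_struct_critical:
  assumes "finite D"
  shows "k_critical S (card D) (full_struct S D)"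
  using assms by (auto simp: k_critical_def full_struct_def is_struct_def)

text \<open>Structures with all tuples satisfy every rule, and an infinite supply of constants
  provides one of each positive finite size.\<close>

lemma critical_if_axiomatizable:
  fixes C :: "('r, 'c) struct set"
  assumes "infinite (UNIV :: 'c set)" and "finitely_axiomatizable S C P"
  shows "critical S C"
  unfolding critical_def
proof (intro allI impI)
  fix \<kappa> :: nat assume "\<kappa> > 0"
  obtain D :: "'c set" where D: "finite D" "card D = \<kappa>"
    using infinite_arbitrarily_large[OF assms(1)] by blast
  then have k: "k_critical S \<kappa> (full_struct S D)"
    using full_struct_critical by blast
  then have "is_struct S (full_struct S D)" by (simp add: k_critical_def)
  moreover have "sat_dexr (full_struct S D) \<sigma>" if "is_dexr S \<sigma>" for \<sigma>
    using k that \<open>\<kappa> > 0\<close> by (intro full_struct_sat_dexr) (auto simp: k_critical_def)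
  ultimately have "full_struct S D \<in> C"
    using assms(2) unfolding finitely_axiomatizable_def by blast
  with k show "\<exists>I\<in>C. k_critical S \<kappa> I" by blast
qed

section \<open>Products with a total structure, with pairs coded as constants\<close>

lemma ex_inj_pair:
  assumes "infinite (UNIV :: 'c::countable set)"
  shows "\<exists>e :: 'c \<times> 'c \<Rightarrow> 'c. inj e"
proof -
  obtain f :: "nat \<Rightarrow> 'c" where "inj f"
    using infinite_countable_subset[OF assms] by blast
  then have "inj (f \<circ> (to_nat :: 'c \<times> 'c \<Rightarrow> nat))" by (simp add: inj_compose)
  then show ?thesis by blast
qed

text \<open>The second factor is total over its whole type, so a single structure covers
  \<open>I \<otimes> J\<close> for all \<open>J\<close>. Its relations hold lists of every length,
  for every symbol; the first factor cuts them down to the schema.\<close>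

definition blow_up :: "('a \<times> 'b \<Rightarrow> 'c) \<Rightarrow> ('r, 'a) struct \<Rightarrow> ('r, 'c) struct" where
  "blow_up e I = rename e (I \<otimes> \<lparr>Dom = UNIV, Rel = (\<lambda>R. UNIV)\<rparr>)"

lemma Dom_blow_up: "Dom (blow_up e I) = e ` (Dom I \<times> UNIV)"
  by (simp add: blow_up_def rename_def direct_product_def)

lemma Rel_blow_up: "Rel (blow_up e I) R = map e ` {ps. map fst ps \<in> Rel I R}"
  by (simp add: blow_up_def rename_def direct_product_def)

lemma is_struct_blow_up:
  assumes "is_struct S I"
  shows "is_struct S (blow_up e I)"
  unfolding is_struct_def
proof (intro conjI ballI allI impI)
  fix R cs assume R: "R \<in> Syms S" and "cs \<in> Rel (blow_up e I) R"
  then obtain ps where ps: "cs = map e ps" "map fst ps \<in> Rel I R"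
    by (auto simp: Rel_blow_up)
  then have "length (map fst ps) = ar S R \<and> set (map fst ps) \<subseteq> Dom I"
    using R assms unfolding is_struct_def by blast
  then show "length cs = ar S R" "set cs \<subseteq> Dom (blow_up e I)"
    by (auto simp: ps(1) Dom_blow_up)
next
  fix R assume "R \<notin> Syms S"
  then show "Rel (blow_up e I) R = {}"
    using assms by (simp add: Rel_blow_up is_struct_def)
qed

lemma is_hom_blow_up:
  assumes "inj e"
  shows "is_hom (fst \<circ> inv e) (blow_up e I) I"
  using assms by (auto simp: is_hom_def Dom_blow_up Rel_blow_up comp_def)

text \<open>Second coordinates are unconstrained, so the projection to \<open>I\<close> not only
  preserves but also reflects truth, as long as all values are codes of pairs.\<close>

lemma holds_blow_up:
  assumes "inj e" and "holds I (fst \<circ> inv e \<circ> w) as"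
    and "\<And>a t. a \<in> set as \<Longrightarrow> t \<in> set (args a) \<Longrightarrow> w t \<in> range e"
  shows "holds (blow_up e I) w as"
  unfolding holds_iff_Rel
proof
  fix a assume a: "a \<in> set as"
  have "map fst (map (inv e \<circ> w) (args a)) \<in> Rel I (sym a)"
    using assms(2) a by (simp add: holds_iff_Rel comp_assoc)
  moreover have "map w (args a) = map e (map (inv e \<circ> w) (args a))"
    using assms(3)[OF a] by (auto simp: f_inv_into_f)
  ultimately show "map w (args a) \<in> Rel (blow_up e I) (sym a)"
    unfolding Rel_blow_up by blast
qed

text \<open>The body is projected to \<open>I\<close>, the rule is applied there, and its witnesses
  are lifted back. Without equality, a rule cannot tell apart two copies of the same
  element.\<close>

lemma sat_dexr_blow_up:
  assumes "inj e" and "is_struct S I" and "sat_dexr I \<sigma>"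
  shows "sat_dexr (blow_up e I) \<sigma>"
  unfolding sat_dexr_iff[OF is_struct_blow_up[OF assms(2)]]
proof (intro allI impI)
  let ?h = "fst \<circ> inv e"
  fix v assume v: "holds (blow_up e I) v (body \<sigma>)"
  then have "holds I (?h \<circ> v) (body \<sigma>)"
    by (rule holds_hom[OF is_hom_blow_up[OF assms(1)]])
  then obtain \<psi> w where \<psi>: "\<psi> \<in> set (heads \<sigma>)"
    and w: "\<forall>x\<in>vars (body \<sigma>). w x = ?h (v x)" "holds I w \<psi>"
    using assms(3) unfolding sat_dexr_iff[OF assms(2)] by fastforce
  \<comment> \<open>A body variable keeps its own copy \<open>v x\<close>. An existential variable
    takes some copy of its witness in \<open>I\<close>; the second coordinate is arbitrary.\<close>
  define w' where "w' = (\<lambda>x. if x \<in> vars (body \<sigma>) then v x else e (w x, undefined))"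
  have "?h \<circ> w' = w"
    using w(1) assms(1) by (auto simp: w'_def)
  moreover have "w' x \<in> range e" for x
    using holds_in_schema(3)[OF is_struct_blow_up[OF assms(2)] v]
    by (fastforce simp: w'_def vars_def Dom_blow_up)
  ultimately have "holds (blow_up e I) w' \<psi>"
    using w(2) by (intro holds_blow_up[OF assms(1)]) (simp_all add: comp_assoc)
  then show "\<exists>\<psi>\<in>set (heads \<sigma>). \<exists>w. (\<forall>x\<in>vars (body \<sigma>). w x = v x) \<and> holds (blow_up e I) w \<psi>"
    using \<psi> by (intro bexI[of _ \<psi>] exI[of _ w']) (auto simp: w'_def)
qed

text \<open>The projection is defined on all of \<open>blow_up e I\<close>, so it is itself the
  homomorphism that extends the projection of \<open>I \<otimes> J\<close>.\<close>

lemma repairable_product_blow_up: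
  fixes I J :: "('r, 'c) struct" and e :: "'c \<times> 'c \<Rightarrow> 'c"
  assumes "inj e" and "is_struct S I"
  shows "repairable_product S I J (blow_up e I)"
proof -
  have "contained (rename e (I \<otimes> J)) (blow_up e I)"
    by (auto simp: contained_def facts_def Rel_blow_up rename_def direct_product_def)
  moreover have "is_hom (fst \<circ> inv e) (blow_up e I) I"
    using assms(1) by (rule is_hom_blow_up)
  moreover have "e ` Dom (I \<otimes> J) \<subseteq> Dom (blow_up e I)"
    by (auto simp: Dom_blow_up direct_product_def)
  moreover have "inj_on e (Dom (I \<otimes> J))"
    using assms(1) inj_on_subset by blast
  ultimately show ?thesis
    unfolding repairable_product_def using is_struct_blow_up[OF assms(2)] assms(1)
    by (intro conjI exI[of _ e] exI[of _ "fst \<circ> inv e"]) auto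
qed

lemma closed_repairable_products_if_axiomatizable:
  fixes C :: "('r, 'c::countable) struct set"
  assumes "infinite (UNIV :: 'c set)" and C: "\<forall>I\<in>C. is_struct S I"
    and "finitely_axiomatizable S C P"
  shows "closed_repairable_products S C"
  unfolding closed_repairable_products_def
proof (intro ballI)
  fix I J assume I: "I \<in> C"
  obtain e :: "'c \<times> 'c \<Rightarrow> 'c" where e: "inj e"
    using ex_inj_pair[OF assms(1)] by blast
  have s: "is_struct S I" using C I by blast
  have "blow_up e I \<in> C"
    using assms(3) I s is_struct_blow_up[OF s, of e] sat_dexr_blow_up[OF e s]
    unfolding finitely_axiomatizable_def by blast
  then show "\<exists>L\<in>C. repairable_product S I J L"
    using repairable_product_blow_up[OF e s] by blast
qed

section \<open>The diagram of a violated rule\<close>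

definition induced :: "('r, 'c) struct \<Rightarrow> 'c set \<Rightarrow> ('r, 'c) struct" where
  "induced I D = \<lparr>Dom = D, Rel = (\<lambda>R. {cs \<in> Rel I R. set cs \<subseteq> D})\<rparr>"

lemma substruct_induced:
  assumes "is_struct S I" and "D \<subseteq> Dom I"
  shows "substruct S (induced I D) I"
  using assms unfolding substruct_def is_struct_def induced_def by auto

lemma holds_induced:
  assumes "holds I v as" and "v ` (\<Union>a\<in>set as. set (args a)) \<subseteq> D"
  shows "holds (induced I D) v as"
  using assms by (fastforce simp: holds_iff_Rel induced_def)

text \<open>This is a head disjunct in the language of diagrams: body variables become the constants
  assigned by \<open>v\<close>, and \<open>g\<close> renumbers the existential variables, since
  diagrams only offer those below \<open>m\<close>.\<close>

definition head_conj ::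
    "'r dexr \<Rightarrow> (nat \<Rightarrow> 'c) \<Rightarrow> (nat \<Rightarrow> nat) \<Rightarrow> ('r, nat) atom list \<Rightarrow> ('r, 'c trm) atom list" where
  "head_conj \<sigma> v g \<psi> =
     map (map_atom id (\<lambda>x. if x \<in> vars (body \<sigma>) then Const (v x) else Var (g x))) \<psi>"

text \<open>Composing \<open>u\<close> with the substitution yields \<open>w\<close>. Injectivity of
  \<open>g\<close> on the existential variables permits the way back, because then no two of them
  compete for a value of \<open>u\<close>.\<close>

lemma holds_head_conj:
  assumes "inj_on g (ex_vars \<sigma> \<psi>)"
  shows "(\<exists>u. holds I (eval_trm u) (head_conj \<sigma> v g \<psi>)) \<longleftrightarrow>
    (\<exists>w. (\<forall>x\<in>vars (body \<sigma>). w x = v x) \<and> holds I w \<psi>)" (is "?L \<longleftrightarrow> ?R")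
proof
  let ?t = "\<lambda>x. if x \<in> vars (body \<sigma>) then Const (v x) else Var (g x)"
  assume ?L
  then obtain u where "holds I (eval_trm u \<circ> ?t) \<psi>"
    unfolding head_conj_def holds_map_atom by blast
  then show ?R by (intro exI[of _ "eval_trm u \<circ> ?t"]) simp
next
  assume ?R
  then obtain w where w: "\<forall>x\<in>vars (body \<sigma>). w x = v x" "holds I w \<psi>" by blast
  define u where "u = w \<circ> inv_into (ex_vars \<sigma> \<psi>) g"
  have "holds I (eval_trm u) (head_conj \<sigma> v g \<psi>)"
    unfolding head_conj_def holds_map_atom
  proof (rule iffD1[OF holds_cong w(2)])
    fix a t assume "a \<in> set \<psi>" "t \<in> set (args a)"
    then have "t \<in> vars \<psi>" by (auto simp: vars_def)
    then show "w t = (eval_trm u \<circ> (\<lambda>x. if x \<in> vars (body \<sigma>) then Const (v x) else Var (g x))) t"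
      using w(1) assms by (auto simp: u_def ex_vars_def)
  qed
  then show ?L by blast
qed

lemma finite_vars [simp]: "finite (vars as)"
  by (simp add: vars_def)

lemma head_conj_in_diag_conjs:
  assumes "is_dexr S \<sigma>" and "\<psi> \<in> set (heads \<sigma>)" and "g ` ex_vars \<sigma> \<psi> \<subseteq> {..<m}"
    and "v ` vars (body \<sigma>) \<subseteq> Dom K"
  shows "head_conj \<sigma> v g \<psi> \<in> diag_conjs S K m"
proof -
  let ?t = "\<lambda>x. if x \<in> vars (body \<sigma>) then Const (v x) else Var (g x)"
  have "map_atom id ?t a \<in> diag_atoms S K m" if a: "a \<in> set \<psi>" for a
  proof -
    obtain R xs where axs: "a = Atom R xs" by (cases a)
    have "R \<in> Syms S" "length xs = ar S R"
      using assms(1,2) a unfolding is_dexr_def axs by force+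
    moreover have "?t x \<in> Const ` Dom K \<union> Var ` {..<m}" if "x \<in> set xs" for x
    proof -
      have "x \<in> vars \<psi>" using a that axs by (force simp: vars_def)
      then show ?thesis using assms(3,4) by (auto simp: ex_vars_def)
    qed
    moreover have "map_atom id ?t a = Atom R (map ?t xs)" by (simp add: axs)
    ultimately show ?thesis
      unfolding diag_atoms_def
      by (intro CollectI exI[of _ R] exI[of _ "map ?t xs"] conjI)
        (simp_all only: length_map set_map image_subset_iff, blast)
  qed
  moreover have "\<psi> \<noteq> []" using assms(1,2) by (auto simp: is_dexr_def)
  ultimately show ?thesis
    unfolding diag_conjs_def head_conj_def by auto
qed

text \<open>If \<open>I\<close> violates \<open>\<sigma>\<close> under \<open>v\<close>, the image
  of the body variables induces a guarded \<open>K\<close>, and the instantiated heads are false in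
  \<open>I\<close>. A member of \<open>C\<close> satisfying the resulting diagram would make the
  body true and all heads false.\<close>

lemma guarded_diag_compatible_if_axiomatizable:
  assumes S: "is_schema S" and C: "\<forall>I\<in>C. is_struct S I"
    and ax: "finitely_axiomatizable S C (\<lambda>\<sigma>. guarded_dexr \<sigma> \<and> nml_dexr n m l \<sigma>)"
  shows "guarded_diag_compatible S C n m l"
  unfolding guarded_diag_compatible_def
proof (intro allI impI)
  fix I assume I: "is_struct S I" and comp: "guarded_diag_compatible_with S C n m l I"
  obtain \<Sigma> where \<Sigma>: "\<forall>\<sigma>\<in>\<Sigma>. is_dexr S \<sigma> \<and> guarded_dexr \<sigma> \<and> nml_dexr n m l \<sigma>"
      "\<forall>I. is_struct S I \<longrightarrow> (I \<in> C \<longleftrightarrow> (\<forall>\<sigma>\<in>\<Sigma>. sat_dexr I \<sigma>))"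
    using ax unfolding finitely_axiomatizable_def by auto
  have "sat_dexr I \<sigma>" if \<sigma>: "\<sigma> \<in> \<Sigma>" for \<sigma>
    unfolding sat_dexr_iff[OF I]
  proof (intro allI impI, rule ccontr)
    fix v assume v: "holds I v (body \<sigma>)"
      and viol: "\<not> (\<exists>\<psi>\<in>set (heads \<sigma>). \<exists>w. (\<forall>x\<in>vars (body \<sigma>). w x = v x) \<and> holds I w \<psi>)"
    have dexr: "is_dexr S \<sigma>" "guarded_dexr \<sigma>" "nml_dexr n m l \<sigma>" using \<Sigma>(1) \<sigma> by auto
    define D where "D = v ` vars (body \<sigma>)"
    define K where "K = induced I D"
    have DomK: "Dom K = D" by (simp add: K_def induced_def)
    have "D \<subseteq> Dom I"
      using holds_in_schema(3)[OF I v] by (auto simp: D_def vars_def)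
    then have sub: "substruct S K I" unfolding K_def by (rule substruct_induced[OF I])
    then have Ks: "is_struct S K" by (simp add: substruct_def)
    have vK: "holds K v (body \<sigma>)"
      unfolding K_def by (rule holds_induced[OF v]) (auto simp: D_def vars_def)
    \<comment> \<open>An empty body yields an empty \<open>K\<close>, which has no facts because
      arities are positive. Otherwise the image of the guard atom is a fact that mentions all of
      \<open>D\<close>.\<close>
    have "guarded_struct K \<and> Dom K = adom K"
    proof (cases "body \<sigma> = []")
      case True
      then have D: "Dom K = {}" by (simp add: DomK D_def vars_def)
      have "facts K = {}"
      proof (rule ccontr)
        assume "facts K \<noteq> {}"
        then obtain R cs where r: "cs \<in> Rel K R" by (auto simp: facts_def)
        then have R: "R \<in> Syms S" using Ks by (auto simp: is_struct_def)
        then have "length cs = ar S R \<and> set cs \<subseteq> Dom K"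
          using r Ks unfolding is_struct_def by blast
        then show False using D R S by (auto simp: is_schema_def)
      qed
      then show ?thesis using D by (simp add: guarded_struct_def adom_def)
    next
      case False
      then obtain a where a: "a \<in> set (body \<sigma>)" "vars (body \<sigma>) \<subseteq> set (args a)"
        using dexr(2) by (auto simp: guarded_dexr_def)
      let ?f = "Atom (sym a) (map v (args a))"
      have f: "?f \<in> facts K" using vK a(1) by (simp add: holds_def)
      have "D \<subseteq> set (args ?f)" using a(2) by (auto simp: D_def)
      moreover have "set (args ?f) \<subseteq> adom K" using f unfolding adom_def by blast
      moreover have "adom K \<subseteq> D" using adom_subset_Dom[OF Ks] DomK by simp
      ultimately have "adom K = set (args ?f)" "Dom K = adom K" using DomK by auto
      then show ?thesis using f unfolding guarded_struct_def by blast
    qed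
    moreover have "finite (Dom K)" by (simp add: DomK D_def)
    moreover have "card (Dom K) \<le> n"
      using dexr(3) card_image_le[of "vars (body \<sigma>)" v]
      by (simp add: DomK D_def nml_dexr_def)
    ultimately have K: "guarded_struct K" "Dom K = adom K" "finite (Dom K)" "card (Dom K) \<le> n"
      by auto
    \<comment> \<open>A disjunct has at most \<open>m\<close> existential variables, so they fit
      injectively into the diagram variables; the numbering is chosen per disjunct.\<close>
    have "\<exists>g. inj_on g (ex_vars \<sigma> \<psi>) \<and> g ` ex_vars \<sigma> \<psi> \<subseteq> {..<m}" if "\<psi> \<in> set (heads \<sigma>)" for \<psi>
    proof -
      have "card (ex_vars \<sigma> \<psi>) \<le> card {..<m}" using dexr(3) that by (simp add: nml_dexr_def)
      moreover have "finite (ex_vars \<sigma> \<psi>)" by (simp add: ex_vars_def)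
      ultimately show ?thesis using card_le_inj[of "ex_vars \<sigma> \<psi>" "{..<m}"] by auto
    qed
    then have "\<forall>\<psi>\<in>set (heads \<sigma>). \<exists>g. inj_on g (ex_vars \<sigma> \<psi>) \<and> g ` ex_vars \<sigma> \<psi> \<subseteq> {..<m}"
      by blast
    from bchoice[OF this] obtain g where
      "\<forall>\<psi>\<in>set (heads \<sigma>). inj_on (g \<psi>) (ex_vars \<sigma> \<psi>) \<and> g \<psi> ` ex_vars \<sigma> \<psi> \<subseteq> {..<m}"
      by blast
    then have g: "inj_on (g \<psi>) (ex_vars \<sigma> \<psi>)" "g \<psi> ` ex_vars \<sigma> \<psi> \<subseteq> {..<m}"
      if "\<psi> \<in> set (heads \<sigma>)" for \<psi>
      using that by blast+
    let ?\<gamma> = "\<lambda>\<psi>. head_conj \<sigma> v (g \<psi>) \<psi>"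
    define G where "G = ?\<gamma> ` set (heads \<sigma>)"
    have conj: "?\<gamma> \<psi> \<in> diag_conjs S K m" if "\<psi> \<in> set (heads \<sigma>)" for \<psi>
      by (rule head_conj_in_diag_conjs[OF dexr(1) that g(2)[OF that]]) (simp add: DomK D_def)
    have sat: "sat_ex J m (?\<gamma> \<psi>) \<longleftrightarrow> (\<exists>w. (\<forall>x\<in>vars (body \<sigma>). w x = v x) \<and> holds J w \<psi>)"
      if "is_struct S J" "\<psi> \<in> set (heads \<sigma>)" for J \<psi>
    proof -
      have "?\<gamma> \<psi> \<noteq> []" using conj[OF that(2)] by (simp add: diag_conjs_def)
      from sat_ex_iff[OF S that(1) this] show ?thesis
        unfolding holds_head_conj[OF g(1)[OF that(2)]] .
    qed
    have "G \<subseteq> neg_conjs S I K m"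
      using conj sat[OF I] viol unfolding G_def neg_conjs_def by blast
    moreover have "card G \<le> l"
    proof -
      have "card G \<le> length (heads \<sigma>)"
        unfolding G_def using card_image_le[of "set (heads \<sigma>)" ?\<gamma>] card_length[of "heads \<sigma>"]
        by simp
      then show ?thesis using dexr(3) by (simp add: nml_dexr_def)
    qed
    moreover have "finite G" by (simp add: G_def)
    ultimately have "is_diagram S m l I K (diagram K m G)" by (auto simp: is_diagram_def)
    then obtain J where J: "J \<in> C" "\<forall>\<delta>\<in>diagram K m G. sat_conjunct J \<delta>"
      using comp sub K unfolding guarded_diag_compatible_with_def by blast
    have Js: "is_struct S J" using C J(1) by blast
    \<comment> \<open>Constants denote themselves, so the same \<open>v\<close> makes the body true
      in \<open>J\<close>. The head disjunct that follows is one that the diagram forbids.\<close>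
    have "facts K \<subseteq> facts J" using J(2) by (force simp: diagram_def)
    then have "holds J v (body \<sigma>)" using vK unfolding holds_def by blast
    then obtain \<psi> where \<psi>: "\<psi> \<in> set (heads \<sigma>)"
        "\<exists>w. (\<forall>x\<in>vars (body \<sigma>). w x = v x) \<and> holds J w \<psi>"
      using \<Sigma>(2) Js J(1) \<sigma> sat_dexr_iff[OF Js] by blast
    then have "sat_ex J m (?\<gamma> \<psi>)" using sat[OF Js] by blast
    moreover have "NotEx m (?\<gamma> \<psi>) \<in> diagram K m G"
      using \<psi>(1) by (simp add: diagram_def G_def)
    ultimately show False using J(2) by fastforce
  qed
  then show "I \<in> C" using \<Sigma>(2) I by blast
qed


section \<open>From closure properties to rules\<close>

text \<open>The sets \<open>A\<close> and its image have equal size, hence so do their complements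
  within the union. The inverse of \<open>u\<close> is completed by a bijection between these
  complements and by the identity elsewhere.\<close>

lemma bij_extending_inverse:
  fixes u :: "'a \<Rightarrow> 'a"
  assumes "finite A" and "inj_on u A"
  shows "\<exists>b. bij b \<and> (\<forall>c\<in>A. b (u c) = c)"
proof -
  let ?B = "A \<union> u ` A"
  have "card (?B - u ` A) = card (?B - A)"
    using assms by (simp add: card_Diff_subset card_image)
  then obtain k where k: "bij_betw k (?B - u ` A) (?B - A)"
    using finite_same_card_bij[of "?B - u ` A" "?B - A"] assms(1) by auto
  let ?i = "inv_into A u"
  let ?b = "\<lambda>x. if x \<in> u ` A then ?i x else if x \<in> ?B then k x else x"
  have "bij_betw ?b (u ` A) A"
    using bij_betw_inv_into[OF inj_on_imp_bij_betw[OF assms(2)]]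
    by (subst bij_betw_cong[of _ _ ?i]) auto
  moreover have "bij_betw ?b (?B - u ` A) (?B - A)"
    using k by (subst bij_betw_cong[of _ _ k]) auto
  ultimately have "bij_betw ?b (u ` A \<union> (?B - u ` A)) (A \<union> (?B - A))"
    by (rule bij_betw_combine) auto
  moreover have "bij_betw ?b (- ?B) (- ?B)"
    by (subst bij_betw_cong[of _ _ id]) auto
  ultimately have "bij_betw ?b ((u ` A \<union> (?B - u ` A)) \<union> - ?B) ((A \<union> (?B - A)) \<union> - ?B)"
    by (rule bij_betw_combine) auto
  moreover have "(u ` A \<union> (?B - u ` A)) \<union> - ?B = UNIV" "(A \<union> (?B - A)) \<union> - ?B = UNIV"
    by auto
  ultimately have "bij ?b" by simp
  moreover have "?b (u c) = c" if "c \<in> A" for c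
    using that assms(2) by simp
  ultimately show ?thesis by blast
qed

text \<open>The third claim serves to pull conjunctions that are true in the renamed structure back
  to \<open>L\<close>.\<close>

lemma rename_in_iso_closed:
  assumes "iso_closed S C" and "L \<in> C" and "is_struct S L" and "bij b"
  shows "rename b L \<in> C" and "is_struct S (rename b L)"
    and "is_hom (inv b) (rename b L) L"
proof -
  have inj: "inj b" using assms(4) by (rule bij_is_inj)
  show "is_struct S (rename b L)"
    using assms(3) by (fastforce simp: is_struct_def rename_def)
  show inv: "is_hom (inv b) (rename b L) L"
    using inj by (auto simp: is_hom_def rename_def comp_def)
  have inv_eq: "inv_into (Dom L) b (b x) = x" if "x \<in> Dom L" for x
    using inj that by (meson inj_on_subset inv_into_f_f subset_UNIV)
  have dom: "set cs \<subseteq> Dom L" if "cs \<in> Rel L R" for R cs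
    using that assms(3) unfolding is_struct_def by (cases "R \<in> Syms S") blast+
  have "map (inv_into (Dom L) b \<circ> b) cs = cs" if "cs \<in> Rel L R" for R cs
    using dom[OF that] inv_eq by (intro map_idI) auto
  then have "is_hom (inv_into (Dom L) b) (rename b L) L"
    using inv_eq by (auto simp: is_hom_def rename_def)
  moreover have "is_hom b L (rename b L)"
    by (auto simp: is_hom_def rename_def)
  moreover have "bij_betw b (Dom L) (Dom (rename b L))"
    using inj by (auto simp: rename_def bij_betw_def intro: inj_on_subset)
  ultimately have "is_iso b L (rename b L)" by (simp add: is_iso_def)
  then show "rename b L \<in> C"
    using assms(1,2) \<open>is_struct S (rename b L)\<close> unfolding iso_closed_def by blast
qed

text \<open>The values \<open>p c\<close> need not be distinct: pairing them with distinct elements of a critical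
  structure makes the inequalities of the diagram true.\<close>

lemma diagram_satisfiable:
  assumes S: "is_schema S" and C: "\<forall>I\<in>C. is_struct S I" and iso: "iso_closed S C"
    and crit: "critical S C" and prod: "closed_repairable_products S C"
    and K: "is_struct S K" "Dom K = adom K" "finite (Dom K)"
    and G: "G \<subseteq> diag_conjs S K m"
    and J: "J \<in> C"
    and p: "\<And>R cs. cs \<in> Rel K R \<Longrightarrow> map p cs \<in> Rel J R"
    and neg: "\<And>\<gamma> u. \<gamma> \<in> G \<Longrightarrow> \<not> holds J (case_trm p u) \<gamma>"
  shows "\<exists>J\<in>C. \<forall>\<delta>\<in>diagram K m G. sat_conjunct J \<delta>"
proof -
  \<comment> \<open>Criticality concerns positive sizes only, while \<open>Dom K\<close> may be
    empty; hence \<open>Suc\<close>.\<close>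
  obtain E where E: "E \<in> C" "k_critical S (Suc (card (Dom K))) E"
    using crit by (auto simp: critical_def)
  then have "finite (Dom E)" "card (Dom K) \<le> card (Dom E)" by (auto simp: k_critical_def)
  then obtain \<iota> where \<iota>: "\<iota> ` Dom K \<subseteq> Dom E" "inj_on \<iota> (Dom K)"
    using card_le_inj[OF K(3)] by blast
  obtain L where L: "L \<in> C" "repairable_product S J E L"
    using prod J E(1) unfolding closed_repairable_products_def by blast
  then obtain e h where e: "inj_on e (Dom (J \<otimes> E))" "contained (rename e (J \<otimes> E)) L"
    and h: "is_hom h L J" "\<forall>q\<in>Dom (J \<otimes> E). h (e q) = fst q"
    and Ls: "is_struct S L"
    unfolding repairable_product_def by blast
  have Js: "is_struct S J" using C J by blast
  \<comment> \<open>The element of \<open>L\<close> that stands for \<open>c\<close>. Its first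
    coordinate is mapped back by \<open>h\<close>, its second makes \<open>u\<close>
    injective.\<close>
  define u where "u = (\<lambda>c. e (p c, \<iota> c))"
  have pD: "p c \<in> Dom J" if c: "c \<in> Dom K" for c
  proof -
    obtain R cs where "cs \<in> Rel K R" "c \<in> set cs"
      using c unfolding K(2) by (auto simp: adom_def facts_def)
    then have "p c \<in> adom J" using p by (force simp: adom_def facts_def)
    then show ?thesis using adom_subset_Dom[OF Js] by blast
  qed
  have q: "(p c, \<iota> c) \<in> Dom (J \<otimes> E)" if "c \<in> Dom K" for c
    using pD[OF that] \<iota>(1) that by (auto simp: direct_product_def)
  have "inj_on u (Dom K)"
    using e(1) q \<iota>(2) unfolding inj_on_def u_def by (metis prod.inject)
  \<comment> \<open>A diagram names its constants, so \<open>L\<close> must be renamed until each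
    \<open>u c\<close> is \<open>c\<close> itself.\<close>
  then obtain b where b: "bij b" "\<forall>c\<in>Dom K. b (u c) = c"
    using bij_extending_inverse[OF K(3)] by blast
  note ren = rename_in_iso_closed[OF iso L(1) Ls b(1)]
  have fact: "cs \<in> Rel (rename b L) R" if cs: "cs \<in> Rel K R" for R cs
  proof -
    have R: "R \<in> Syms S" using cs K(1) by (auto simp: is_struct_def)
    then have l: "length cs = ar S R \<and> set cs \<subseteq> Dom K"
      using cs K(1) unfolding is_struct_def by blast
    have "map \<iota> cs \<in> Rel E R"
      using l \<iota>(1) E(2) R by (auto simp: k_critical_def)
    then have "map (\<lambda>c. (p c, \<iota> c)) cs \<in> Rel (J \<otimes> E) R"
      using p[OF cs] by (simp add: direct_product_def comp_def)
    then have "map e (map (\<lambda>c. (p c, \<iota> c)) cs) \<in> Rel (rename e (J \<otimes> E)) R"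
      unfolding rename_def struct.simps by (rule imageI)
    then have "map u cs \<in> Rel L R"
      using e(2) by (auto simp: contained_def facts_def u_def comp_def)
    then have "map b (map u cs) \<in> Rel (rename b L) R"
      unfolding rename_def struct.simps by (rule imageI)
    moreover have "map b (map u cs) = cs"
      using b(2) l by (auto intro!: map_idI)
    ultimately show ?thesis by simp
  qed
  have nex: "\<not> sat_ex (rename b L) m \<gamma>" if \<gamma>: "\<gamma> \<in> G" for \<gamma>
  proof
    have \<gamma>K: "\<gamma> \<noteq> []" "set \<gamma> \<subseteq> diag_atoms S K m"
      using G \<gamma> by (auto simp: diag_conjs_def)
    assume "sat_ex (rename b L) m \<gamma>"
    then obtain w where "holds (rename b L) (eval_trm w) \<gamma>"
      by (auto simp: sat_ex_def)
    \<comment> \<open>A forbidden conjunction true in the renamed structure travels to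
      \<open>L\<close> and on to \<open>J\<close>, where the constant \<open>c\<close> arrives at
      \<open>p c\<close>; this is what \<open>neg\<close> excludes.\<close>
    then have hJ: "holds J (h \<circ> (inv b \<circ> eval_trm w)) \<gamma>"
      by (intro holds_hom[OF h(1)] holds_hom[OF ren(3)])
    have "holds J (case_trm p (h \<circ> inv b \<circ> w)) \<gamma>"
    proof (rule iffD1[OF holds_cong hJ])
      fix a t assume "a \<in> set \<gamma>" "t \<in> set (args a)"
      then have t: "t \<in> Const ` Dom K \<union> Var ` {..<m}"
        using \<gamma>K(2) by (force simp: diag_atoms_def)
      show "(h \<circ> (inv b \<circ> eval_trm w)) t = case_trm p (h \<circ> inv b \<circ> w) t"
      proof (cases t)
        case (Const c)
        then have c: "c \<in> Dom K" using t by auto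
        then have "inv b c = u c" using b bij_is_inj by (metis inv_f_f)
        then show ?thesis using h(2) q[OF c] by (simp add: Const u_def)
      qed simp
    qed
    then show False using neg \<gamma> by blast
  qed
  have "sat_conjunct (rename b L) \<delta>" if "\<delta> \<in> diagram K m G" for \<delta>
    using that fact nex by (auto simp: diagram_def facts_def)
  then show ?thesis using ren(1) by blast
qed

section \<open>A finite stock of rules, and the rule of a diagram\<close>

definition atoms_below :: "'r schema \<Rightarrow> nat \<Rightarrow> ('r, nat) atom set" where
  "atoms_below S k =
     {Atom R xs | R xs. R \<in> Syms S \<and> length xs = ar S R \<and> set xs \<subseteq> {..<k}}"

text \<open>Lists can repeat atoms without end. Distinctness bounds bodies and disjuncts, which
  together with the bound on the number of disjuncts leaves finitely many rules.\<close>

definition rules_below :: "'r schema \<Rightarrow> nat \<Rightarrow> nat \<Rightarrow> 'r dexr set" where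
  "rules_below S k l = {\<sigma>. distinct (body \<sigma>) \<and> set (body \<sigma>) \<subseteq> atoms_below S k \<and>
     length (heads \<sigma>) \<le> l \<and>
     (\<forall>\<psi>\<in>set (heads \<sigma>). distinct \<psi> \<and> set \<psi> \<subseteq> atoms_below S k)}"

lemma finite_atoms:
  assumes "is_schema S" and "finite X"
  shows "finite {Atom R xs | R xs. R \<in> Syms S \<and> length xs = ar S R \<and> set xs \<subseteq> X}"
proof -
  have "finite (\<Union>R\<in>Syms S. Atom R ` {xs. set xs \<subseteq> X \<and> length xs = ar S R})"
    using assms finite_lists_length_eq[OF assms(2)] by (auto simp: is_schema_def)
  then show ?thesis by (rule finite_subset[rotated]) auto
qed

lemma finite_rules_below:
  assumes "is_schema S"
  shows "finite (rules_below S k l)"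
proof -
  let ?A = "atoms_below S k"
  let ?D = "{as. distinct as \<and> set as \<subseteq> ?A}"
  have "finite ?A" unfolding atoms_below_def using assms by (rule finite_atoms) simp
  then have D: "finite ?D" by (rule finite_subset[rotated, OF finite_subset_distinct]) auto
  then have "finite ((\<lambda>(b, hs). \<lparr>body = b, heads = hs\<rparr>) `
      (?D \<times> {hs. set hs \<subseteq> ?D \<and> length hs \<le> l}))"
    using finite_lists_length_le[OF D] by blast
  moreover have "rules_below S k l \<subseteq> (\<lambda>(b, hs). \<lparr>body = b, heads = hs\<rparr>) `
      (?D \<times> {hs. set hs \<subseteq> ?D \<and> length hs \<le> l})"
  proof
    fix \<sigma> assume "\<sigma> \<in> rules_below S k l"
    then have "(body \<sigma>, heads \<sigma>) \<in> ?D \<times> {hs. set hs \<subseteq> ?D \<and> length hs \<le> l}"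
      by (auto simp: rules_below_def)
    moreover have "\<sigma> = (\<lambda>(b, hs). \<lparr>body = b, heads = hs\<rparr>) (body \<sigma>, heads \<sigma>)" by simp
    ultimately show "\<sigma> \<in> (\<lambda>(b, hs). \<lparr>body = b, heads = hs\<rparr>) `
      (?D \<times> {hs. set hs \<subseteq> ?D \<and> length hs \<le> l})" by (rule rev_image_eqI)
  qed
  ultimately show ?thesis by (rule finite_subset[rotated])
qed

lemma finite_facts:
  assumes "is_schema S" and "is_struct S K" and "finite (Dom K)"
  shows "finite (facts K)"
proof (rule finite_subset[OF _ finite_atoms[OF assms(1,3)]])
  show "facts K \<subseteq> {Atom R xs | R xs. R \<in> Syms S \<and> length xs = ar S R \<and> set xs \<subseteq> Dom K}"
    using assms(2) unfolding is_struct_def facts_def by blast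
qed

text \<open>The rule obtained from a diagram by dropping the inequalities and moving the negated
  conjunctions into the head. The elements of \<open>K\<close> become the variables below \<open>n\<close>.\<close>

lemma diagram_rule:
  fixes K :: "('r, 'c) struct"
  assumes S: "is_schema S"
    and K: "is_struct S K" "guarded_struct K" "Dom K = adom K" "finite (Dom K)" "card (Dom K) \<le> n"
    and G: "G \<subseteq> diag_conjs S K m" "finite G" "card G \<le> l" "G \<noteq> {}"
  obtains \<sigma> where "\<sigma> \<in> rules_below S (n + m) l"
    and "is_dexr S \<sigma>" and "guarded_dexr \<sigma>" and "nml_dexr n m l \<sigma>"
    and "\<And>J :: ('r, 'd) struct. is_struct S J \<Longrightarrow> sat_dexr J \<sigma> \<longleftrightarrow>
      (\<forall>p. (\<forall>R. \<forall>cs\<in>Rel K R. map p cs \<in> Rel J R) \<longrightarrow>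
         (\<exists>\<gamma>\<in>G. \<exists>u. holds J (case_trm p u) \<gamma>))"
proof -
  obtain \<iota> where \<iota>: "\<iota> ` Dom K \<subseteq> {..<n}" "inj_on \<iota> (Dom K)"
    using card_le_inj[OF K(4), of "{..<n}"] K(5) by auto
  \<comment> \<open>Diagram variables are shifted by \<open>n\<close>, away from the variables below
    \<open>n\<close> that stand for elements of \<open>K\<close>. The \<open>remdups\<close> below
    gives the disjuncts the form that \<open>rules_below\<close> demands.\<close>
  define f where "f = case_trm \<iota> ((+) n)"
  define hd where "hd = (\<lambda>\<gamma>. remdups (map (map_atom (id :: 'r \<Rightarrow> 'r) f) \<gamma>))"
  have "finite (map_atom id \<iota> ` facts K)"
    using finite_facts[OF S K(1,4)] by (rule finite_imageI)
  from finite_distinct_list[OF this]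
  obtain B where B: "set B = map_atom id \<iota> ` facts K" "distinct B" by blast
  have "finite (hd ` G)" using G(2) by (rule finite_imageI)
  from finite_distinct_list[OF this]
  obtain H where H: "set H = hd ` G" "distinct H" by blast
  define \<sigma> where "\<sigma> = \<lparr>body = B, heads = H\<rparr>"
  have bs: "body \<sigma> = B" "heads \<sigma> = H" by (simp_all add: \<sigma>_def)
  have lenH: "length H \<le> l"
    using distinct_card[OF H(2)] card_image_le[OF G(2), of hd] G(3) by (simp add: H(1))
  \<comment> \<open>As \<open>Dom K = adom K\<close>, every element of \<open>K\<close> occurs in
    the body. Constants of a conjunction thus become body variables, and only the shifted variables
    are existential.\<close>
  have vB: "vars B = \<iota> ` Dom K"
    unfolding vars_def B(1) K(3) adom_def by (auto simp: atom.map_sel)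
  have factsK: "R \<in> Syms S \<and> length cs = ar S R \<and> set cs \<subseteq> Dom K" if "Atom R cs \<in> facts K" for R cs
  proof -
    have "R \<in> Syms S" using that K(1) by (auto simp: is_struct_def)
    then show ?thesis using that K(1) unfolding is_struct_def by auto
  qed
  have Bbelow: "set B \<subseteq> atoms_below S (n + m)"
  proof
    fix a assume "a \<in> set B"
    then obtain R cs where a: "Atom R cs \<in> facts K" "a = Atom R (map \<iota> cs)"
      unfolding B(1) by (auto simp: facts_def)
    then show "a \<in> atoms_below S (n + m)"
      using factsK[OF a(1)] \<iota>(1) by (fastforce simp: atoms_below_def)
  qed
  have hdbelow: "set (hd \<gamma>) \<subseteq> atoms_below S (n + m)" if "\<gamma> \<in> G" for \<gamma>
  proof
    fix a assume "a \<in> set (hd \<gamma>)"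
    then obtain R us where a: "Atom R us \<in> set \<gamma>" "a = Atom R (map f us)"
      by (auto simp: hd_def) (metis atom.exhaust atom.map id_apply)
    then have us: "R \<in> Syms S" "length us = ar S R" "set us \<subseteq> Const ` Dom K \<union> Var ` {..<m}"
      using that G(1) by (auto simp: diag_conjs_def diag_atoms_def)
    have "f t < n + m" if "t \<in> set us" for t
      using us(3) that \<iota>(1) by (fastforce simp: f_def)
    then show "a \<in> atoms_below S (n + m)"
      using us(1,2) by (auto simp: atoms_below_def a(2))
  qed
  have hdne: "hd \<gamma> \<noteq> []" if "\<gamma> \<in> G" for \<gamma>
    using that G(1) by (auto simp: hd_def diag_conjs_def)
  have rb: "\<sigma> \<in> rules_below S (n + m) l"
    using B(2) Bbelow lenH hdbelow by (auto simp: rules_below_def bs H(1) hd_def)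
  have dexr: "is_dexr S \<sigma>"
  proof -
    have "sym a \<in> Syms S \<and> length (args a) = ar S (sym a)" if "a \<in> atoms_below S (n + m)" for a
      using that by (auto simp: atoms_below_def)
    then show ?thesis
      unfolding is_dexr_def bs using H(1) G(4) hdne hdbelow Bbelow by fastforce
  qed
  have guarded: "guarded_dexr \<sigma>"
  proof (cases "facts K = {}")
    case True
    then show ?thesis using B(1) by (simp add: guarded_dexr_def bs)
  next
    case False
    then obtain a where a: "a \<in> facts K" "adom K = set (args a)"
      using K(2) by (auto simp: guarded_struct_def)
    then have "map_atom id \<iota> a \<in> set B" "vars B \<subseteq> set (args (map_atom id \<iota> a))"
      using K(3) by (auto simp: B(1) vB atom.map_sel)
    then show ?thesis unfolding guarded_dexr_def bs by blast
  qed
  have "card (ex_vars \<sigma> (hd \<gamma>)) \<le> m" if "\<gamma> \<in> G" for \<gamma>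
  proof -
    have "ex_vars \<sigma> (hd \<gamma>) \<subseteq> (+) n ` {..<m}"
    proof
      fix x assume x: "x \<in> ex_vars \<sigma> (hd \<gamma>)"
      then obtain a t where a: "a \<in> set \<gamma>" "t \<in> set (args a)" "x = f t"
        by (auto simp: ex_vars_def vars_def hd_def atom.map_sel)
      then have "t \<in> Const ` Dom K \<union> Var ` {..<m}"
        using that G(1) by (fastforce simp: diag_conjs_def diag_atoms_def)
      then show "x \<in> (+) n ` {..<m}"
        using x a(3) by (auto simp: ex_vars_def bs vB f_def)
    qed
    then show ?thesis using surj_card_le[of "{..<m}"] by fastforce
  qed
  moreover have "card (vars B) \<le> n"
    using card_image_le[OF K(4), of \<iota>] K(5) by (simp add: vB)
  ultimately have nml: "nml_dexr n m l \<sigma>"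
    using lenH by (simp add: nml_dexr_def bs H(1))
  have holds_hd: "holds J w (hd \<gamma>) \<longleftrightarrow> holds J (w \<circ> f) \<gamma>" for J :: "('r, 'd) struct" and w \<gamma>
    using holds_map_atom[of J w f \<gamma>] by (simp add: hd_def holds_def)
  have holds_B: "holds J w B \<longleftrightarrow> (\<forall>R. \<forall>cs\<in>Rel K R. map (w \<circ> \<iota>) cs \<in> Rel J R)"
    for J :: "('r, 'd) struct" and w
    unfolding holds_iff_Rel B(1) by (fastforce simp: facts_def)
  have sat: "sat_dexr J \<sigma> \<longleftrightarrow>
      (\<forall>p. (\<forall>R. \<forall>cs\<in>Rel K R. map p cs \<in> Rel J R) \<longrightarrow>
         (\<exists>\<gamma>\<in>G. \<exists>u. holds J (case_trm p u) \<gamma>))" (is "_ \<longleftrightarrow> ?R")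
    if J: "is_struct S J" for J :: "('r, 'd) struct"
  proof
    assume sat: "sat_dexr J \<sigma>"
    show ?R
    proof (intro allI impI)
      fix p assume p: "\<forall>R. \<forall>cs\<in>Rel K R. map p cs \<in> Rel J R"
      \<comment> \<open>The map \<open>p\<close> on elements of \<open>K\<close> is read as a
        valuation of the variables that stand for them.\<close>
      define v where "v = p \<circ> inv_into (Dom K) \<iota>"
      have v: "v (\<iota> c) = p c" if "c \<in> Dom K" for c
        using that \<iota>(2) by (simp add: v_def)
      have "map (v \<circ> \<iota>) cs = map p cs" if "cs \<in> Rel K R" for R cs
        using factsK[of R cs] that v by auto
      then have "holds J v B" unfolding holds_B using p by metis
      then obtain \<gamma> w where \<gamma>: "\<gamma> \<in> G" "\<forall>x\<in>vars B. w x = v x" "holds J w (hd \<gamma>)"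
        using sat unfolding sat_dexr_iff[OF J] bs H(1) by blast
      have "holds J (case_trm p (w \<circ> (+) n)) \<gamma>"
      proof (rule iffD1[OF holds_cong \<gamma>(3)[unfolded holds_hd]])
        fix a t assume "a \<in> set \<gamma>" "t \<in> set (args a)"
        then have t: "t \<in> Const ` Dom K \<union> Var ` {..<m}"
          using \<gamma>(1) G(1) by (fastforce simp: diag_conjs_def diag_atoms_def)
        then show "(w \<circ> f) t = case_trm p (w \<circ> (+) n) t"
          using \<gamma>(2) v by (auto simp: f_def vB)
      qed
      then show "\<exists>\<gamma>\<in>G. \<exists>u. holds J (case_trm p u) \<gamma>" using \<gamma>(1) by blast
    qed
  next
    assume R: ?R
    show "sat_dexr J \<sigma>"
      unfolding sat_dexr_iff[OF J] bs
    proof (intro allI impI)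
      fix v assume "holds J v B"
      then obtain \<gamma> u where \<gamma>: "\<gamma> \<in> G" "holds J (case_trm (v \<circ> \<iota>) u) \<gamma>"
        using R unfolding holds_B by blast
      \<comment> \<open>The variables from \<open>n\<close> on are shifted diagram variables;
        subtracting \<open>n\<close> recovers their index in \<open>u\<close>.\<close>
      define w where "w = (\<lambda>x. if x < n then v x else u (x - n))"
      have "holds J (w \<circ> f) \<gamma>"
      proof (rule iffD1[OF holds_cong \<gamma>(2)])
        fix a t assume "a \<in> set \<gamma>" "t \<in> set (args a)"
        then have t: "t \<in> Const ` Dom K \<union> Var ` {..<m}"
          using \<gamma>(1) G(1) by (fastforce simp: diag_conjs_def diag_atoms_def)
        then show "case_trm (v \<circ> \<iota>) u t = (w \<circ> f) t"
          using \<iota>(1) by (auto simp: f_def w_def)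
      qed
      then have "holds J w (hd \<gamma>)" by (simp add: holds_hd)
      moreover have "\<forall>x\<in>vars B. w x = v x" using \<iota>(1) by (auto simp: vB w_def)
      ultimately show "\<exists>\<psi>\<in>set H. \<exists>w. (\<forall>x\<in>vars B. w x = v x) \<and> holds J w \<psi>"
        using \<gamma>(1) unfolding H(1) by blast
    qed
  qed
  show thesis by (rule that[OF rb dexr guarded nml sat])
qed

text \<open>The axioms are the rules of the finite stock that are valid in \<open>C\<close>. For a
  diagram of a model \<open>I\<close> of these, the associated rule fails in \<open>I\<close> and so
  is not valid in \<open>C\<close>; a member of \<open>C\<close> violating it is then repaired into
  one satisfying the diagram.\<close>

lemma axiomatizable_if_closed:
  fixes C :: "('r, 'c) struct set"
  assumes S: "is_schema S" and C: "\<forall>I\<in>C. is_struct S I" and iso: "iso_closed S C"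
    and crit: "critical S C" and prod: "closed_repairable_products S C"
    and comp: "guarded_diag_compatible S C n m l"
  shows "finitely_axiomatizable S C (\<lambda>\<sigma>. guarded_dexr \<sigma> \<and> nml_dexr n m l \<sigma>)"
proof -
  define \<Sigma> where "\<Sigma> = {\<sigma> \<in> rules_below S (n + m) l.
    is_dexr S \<sigma> \<and> guarded_dexr \<sigma> \<and> nml_dexr n m l \<sigma> \<and> (\<forall>J\<in>C. sat_dexr J \<sigma>)}"
  have "I \<in> C" if I: "is_struct S I" and sat: "\<forall>\<sigma>\<in>\<Sigma>. sat_dexr I \<sigma>" for I
  proof -
    have "\<exists>J\<in>C. \<forall>\<delta>\<in>\<Delta>. sat_conjunct J \<delta>"
      if sub: "substruct S K I" and K: "guarded_struct K" "Dom K = adom K" "finite (Dom K)"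
        "card (Dom K) \<le> n" and \<Delta>: "is_diagram S m l I K \<Delta>" for K \<Delta>
    proof -
      have Ks: "is_struct S K" using sub by (simp add: substruct_def)
      obtain G where G: "G \<subseteq> neg_conjs S I K m" "finite G" "card G \<le> l" "\<Delta> = diagram K m G"
        using \<Delta> by (auto simp: is_diagram_def)
      then have Gc: "G \<subseteq> diag_conjs S K m" by (auto simp: neg_conjs_def)
      have KI: "cs \<in> Rel I R" if "cs \<in> Rel K R" for R cs
      proof -
        have "R \<in> Syms S" using that Ks by (auto simp: is_struct_def)
        then show ?thesis using that sub unfolding substruct_def by blast
      qed
      have "\<exists>J\<in>C. \<exists>p. (\<forall>R. \<forall>cs\<in>Rel K R. map p cs \<in> Rel J R) \<and>
          (\<forall>\<gamma>\<in>G. \<forall>u. \<not> holds J (case_trm p u) \<gamma>)"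
      \<comment> \<open>A rule needs a head, so a diagram without negated conjunctions is treated
        apart: collapsing \<open>K\<close> to the single element of a critical structure preserves
        its facts.\<close>
      proof (cases "G = {}")
        case True
        obtain E where E: "E \<in> C" "k_critical S 1 E"
          using crit by (auto simp: critical_def)
        then obtain d where d: "d \<in> Dom E" by (fastforce simp: k_critical_def)
        have "map (\<lambda>_. d) cs \<in> Rel E R" if "cs \<in> Rel K R" for R cs
        proof -
          have R: "R \<in> Syms S" using that Ks by (auto simp: is_struct_def)
          then have "length cs = ar S R" using that Ks unfolding is_struct_def by blast
          then show ?thesis using R d E(2) by (auto simp: k_critical_def)
        qed
        then show ?thesis using E(1) True by blast
      next
        case False
        obtain \<sigma> where \<sigma>: "\<sigma> \<in> rules_below S (n + m) l" "is_dexr S \<sigma>" "guarded_dexr \<sigma>"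
            "nml_dexr n m l \<sigma>"
          and sem: "\<And>J :: ('r, 'c) struct. is_struct S J \<Longrightarrow> sat_dexr J \<sigma> \<longleftrightarrow>
            (\<forall>p. (\<forall>R. \<forall>cs\<in>Rel K R. map p cs \<in> Rel J R) \<longrightarrow>
               (\<exists>\<gamma>\<in>G. \<exists>u. holds J (case_trm p u) \<gamma>))"
          using diagram_rule[OF S Ks K Gc G(2,3) False] by metis
        \<comment> \<open>The identity makes the body true in \<open>I\<close>, since
          \<open>K\<close> is a substructure, while every conjunction in \<open>G\<close> is false
          in \<open>I\<close>.\<close>
        have "\<not> sat_dexr I \<sigma>"
        proof
          assume "sat_dexr I \<sigma>"
          then obtain \<gamma> u where \<gamma>: "\<gamma> \<in> G" "holds I (case_trm id u) \<gamma>"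
            using KI sem[OF I] by (metis list.map_id)
          have "case_trm id u = eval_trm u"
          proof
            fix t show "case_trm id u t = eval_trm u t" by (cases t) auto
          qed
          then have "sat_ex I m \<gamma>"
            using \<gamma> Gc sat_ex_iff[OF S I] by (auto simp: diag_conjs_def)
          then show False using \<gamma>(1) G(1) by (auto simp: neg_conjs_def)
        qed
        then have "\<sigma> \<notin> \<Sigma>" using sat by blast
        \<comment> \<open>The rule has every syntactic property asked of axioms, so only validity in
          \<open>C\<close> can fail.\<close>
        then obtain J where "J \<in> C" "\<not> sat_dexr J \<sigma>" using \<sigma> by (auto simp: \<Sigma>_def)
        then show ?thesis using sem C by blast
      qed
      then show ?thesis
        unfolding G(4)
        using diagram_satisfiable[OF S C iso crit prod Ks K(2,3) Gc] by blast
    qed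
    then have "guarded_diag_compatible_with S C n m l I"
      unfolding guarded_diag_compatible_with_def by blast
    then show ?thesis using comp I unfolding guarded_diag_compatible_def by blast
  qed
  moreover have "finite \<Sigma>"
    using finite_rules_below[OF S] by (simp add: \<Sigma>_def)
  ultimately show ?thesis
    unfolding finitely_axiomatizable_def
    by (intro exI[of _ \<Sigma>]) (auto simp: \<Sigma>_def)
qed

theorem theorem3:
  fixes S :: "'r schema"
    and C :: "('r, 'c::countable) struct set"
    and n m l :: nat
  assumes "infinite (UNIV :: 'c set)"
    and "is_schema S"
    and "\<forall>I\<in>C. is_struct S I"
    and "iso_closed S C"
    and "n + m > 0" and "l > 0"
  shows "finitely_axiomatizable S C (\<lambda>\<sigma>. guarded_dexr \<sigma> \<and> nml_dexr n m l \<sigma>) \<longleftrightarrow>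
    critical S C \<and> closed_repairable_products S C \<and> guarded_diag_compatible S C n m l"
  using critical_if_axiomatizable[OF assms(1)]
    closed_repairable_products_if_axiomatizable[OF assms(1,3)]
    guarded_diag_compatible_if_axiomatizable[OF assms(2,3)]
    axiomatizable_if_closed[OF assms(2,3,4)]
  by blast

end
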